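(* Let $(l_k)_{k=1}^\infty$ be a strictly increasing sequence of natural numbers such that $\lim_{k\to\infty} l_k/k=\infty$. Define the compact sets $$A_k=\overline{\{x\in[0,1] : x_{l_k+1}\ldots x_{l_k+k}\neq 0^k\}},$$ where $x=0.x_1x_2\ldots$ is the binary expansion of $x$, and let $$B_n=\bigcap_{k=n}^\infty A_k .$$ Then $\dim_{\mathrm F}B_n=0$ for all $n$. On the other hand, with $\lambda$ denoting Lebesgue measure on $[0,1]$, $\lambda(B_n)\ge 1-2^{-(n-1)}$ for each $n$, so that $\lambda\big(\bigcup_{n=1}^\infty B_n\big)=1$ and hence $$\dim_{\mathrm F}\Big(\bigcup_{n=1}^\infty B_n\Big)=1,$$ while $$\dim_{\mathrm{FC}}\Big(\bigcup_{n=1}^\infty B_n\Big)=0.$$ Consequently the Fourier dimension is not countably stable, and the compact Fourier dimension $\dim_{\mathrm{FC}}$ is different from the Fourier dimension $\dim_{\mathrm F}$.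
   Context: For a finite Borel measure $\mu$ on $\mathbb{R}^d$ (here $d=1$), $\widehat\mu(\xi)=\int e^{-2\pi i \xi\cdot x}\,d\mu(x)$. The notation $f(\xi)\lesssim g(\xi)$ means there is a constant $M$ with $|f(\xi)|\le M|g(\xi)|$ for all $\xi$ (negative powers of $|\xi|$ are read as $+\infty$ at $\xi=0$). For a Borel set $A\subset\mathbb{R}^d$, $\mathcal{P}(A)$ is the set of Borel probability measures on $\mathbb{R}^d$ that give full measure to $A$. The Fourier dimension of $A$ is $\dim_{\mathrm{F}}A=\sup\{s\in[0,d]:\ \widehat\mu(\xi)\lesssim|\xi|^{-s/2} \text{ for some } \mu\in\mathcal{P}(A)\}$. The compact Fourier dimension of $A$ is $\dim_{\mathrm{FC}}A=\sup\{s\in[0,d]:\ \widehat\mu(\xi)\lesssim|\xi|^{-s/2}\text{ for some }\mu\in\mathcal{P}(K)\text{ with }K\subset A\text{ compact}\}$. The bar denotes topological closure, and $0^k$ denotes the string of $k$ zeros. Countable stability of a dimension $\dim$ means $\dim(\bigcup_k A_k)=\sup_k\dim A_k$ for all countable families of Borel sets. *)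

theory Defs
  imports "HOL-Probability.Probability"
begin

definition fourier_transform :: "'a::euclidean_space measure \<Rightarrow> 'a \<Rightarrow> complex" where
  "fourier_transform \<mu> \<xi> = (CLINT x|\<mu>. exp (- (2 * of_real pi * \<i> * of_real (\<xi> \<bullet> x))))"

definition prob_measures_on :: "'a::euclidean_space set \<Rightarrow> 'a measure set" where
  "prob_measures_on A = {\<mu>. prob_space \<mu> \<and> sets \<mu> = sets borel \<and> emeasure \<mu> A = 1}"

text \<open>The bound is only required for \<open>\<xi> \<noteq> 0\<close>: negative powers of \<open>\<bar>\<xi>\<bar>\<close> count as
  \<open>+\<infinity>\<close> at the origin, and for \<open>s = 0\<close> the bound at the origin can be met by enlarging \<open>M\<close>.
  (In HOL, \<open>0 powr a = 0\<close> for every \<open>a\<close>.)\<close>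

definition fourier_decay :: "real \<Rightarrow> 'a::euclidean_space measure \<Rightarrow> bool" where
  "fourier_decay s \<mu> \<longleftrightarrow>
     (\<exists>M::real. \<forall>\<xi>. \<xi> \<noteq> 0 \<longrightarrow> norm (fourier_transform \<mu> \<xi>) \<le> M * norm \<xi> powr (- s / 2))"

text \<open>The suprema are taken in \<^typ>\<open>ennreal\<close>, so that the supremum of the empty set
  (which occurs only when there is no admissible measure at all, e.g. for \<open>A = {}\<close>) is 0.\<close>

definition fourier_dim :: "'a::euclidean_space set \<Rightarrow> ennreal" where
  "fourier_dim A =
     Sup {ennreal s |s. s \<in> {0..real DIM('a)} \<and> (\<exists>\<mu>\<in>prob_measures_on A. fourier_decay s \<mu>)}"

definition compact_fourier_dim :: "'a::euclidean_space set \<Rightarrow> ennreal" where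
  "compact_fourier_dim A =
     Sup {ennreal s |s. s \<in> {0..real DIM('a)} \<and>
       (\<exists>K. compact K \<and> K \<subseteq> A \<and> (\<exists>\<mu>\<in>prob_measures_on K. fourier_decay s \<mu>))}"

definition countably_stable :: "('a::topological_space set \<Rightarrow> ennreal) \<Rightarrow> bool" where
  "countably_stable D \<longleftrightarrow>
     (\<forall>A :: nat \<Rightarrow> 'a set. (\<forall>k. A k \<in> sets borel) \<longrightarrow> D (\<Union>k. A k) = (SUP k. D (A k)))"

text \<open>\<open>bin_digit x j\<close> is the digit \<open>x\<^sub>j\<close> (\<open>j \<ge> 1\<close>) of \<open>x = 0.x\<^sub>1x\<^sub>2\<dots>\<close>. Dyadic rationals in
  \<open>[0,1)\<close> get their terminating expansion, and \<open>1 = 0.111\<dots>\<close>. The choice of expansion does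
  not affect the closed sets \<open>block_set l k\<close> with \<open>k \<ge> 1\<close>.\<close>

definition bin_digit :: "real \<Rightarrow> nat \<Rightarrow> int" where
  "bin_digit x j = (if x = 1 then 1 else \<lfloor>2 ^ j * x\<rfloor> mod 2)"

lemma bin_digit_range: "bin_digit x j \<in> {0, 1}"
  by (auto simp: bin_digit_def)

lemma bin_digit_sums:
  assumes "x \<in> {0..1}"
  shows "(\<lambda>j. real_of_int (bin_digit x (Suc j)) / 2 ^ Suc j) sums x"
proof (cases "x = 1")
  case True
  then show ?thesis
    using power_half_series by (simp add: bin_digit_def power_one_over)
next
  case False
  have step: "bin_digit x (Suc j) = \<lfloor>2 ^ Suc j * x\<rfloor> - 2 * \<lfloor>2 ^ j * x\<rfloor>" for j
  proof -
    have "\<lfloor>2 ^ Suc j * x\<rfloor> div 2 = \<lfloor>2 ^ j * x\<rfloor>"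
      using floor_divide_real_eq_div[of 2 "2 ^ Suc j * x"] by simp
    then show ?thesis
      using False by (simp add: bin_digit_def minus_mult_div_eq_mod [symmetric])
  qed
  have partial: "(\<Sum>j<n. real_of_int (bin_digit x (Suc j)) / 2 ^ Suc j) = \<lfloor>2 ^ n * x\<rfloor> / 2 ^ n" for n
  proof (induction n)
    case 0
    have "\<lfloor>x\<rfloor> = 0" using assms False by (simp add: floor_eq_iff)
    then show ?case by simp
  next
    case (Suc n)
    then show ?case by (simp only: sum.lessThan_Suc step) (simp add: field_simps)
  qed
  have "(\<lambda>n. \<lfloor>2 ^ n * x\<rfloor> / 2 ^ n) \<longlonglongrightarrow> x"
  proof (rule tendsto_sandwich)
    show "\<forall>\<^sub>F n in sequentially. x - (1/2) ^ n \<le> \<lfloor>2 ^ n * x\<rfloor> / 2 ^ n"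
    proof (intro always_eventually allI)
      fix n
      have "2 ^ n * x - 1 \<le> \<lfloor>2 ^ n * x\<rfloor>" by linarith
      then have "(2 ^ n * x - 1) / 2 ^ n \<le> \<lfloor>2 ^ n * x\<rfloor> / 2 ^ n"
        by (intro divide_right_mono) auto
      then show "x - (1/2) ^ n \<le> \<lfloor>2 ^ n * x\<rfloor> / 2 ^ n"
        by (simp add: diff_divide_distrib power_one_over)
    qed
    show "\<forall>\<^sub>F n in sequentially. \<lfloor>2 ^ n * x\<rfloor> / 2 ^ n \<le> x"
    proof (intro always_eventually allI)
      fix n
      have "\<lfloor>2 ^ n * x\<rfloor> \<le> 2 ^ n * x" by linarith
      then show "\<lfloor>2 ^ n * x\<rfloor> / 2 ^ n \<le> x" by (simp add: field_simps)
    qed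
    have "(\<lambda>n. x - (1/2) ^ n) \<longlonglongrightarrow> x - 0"
      by (intro tendsto_intros LIMSEQ_realpow_zero) auto
    then show "(\<lambda>n. x - (1/2) ^ n) \<longlonglongrightarrow> x" by simp
  qed simp
  then show ?thesis by (simp only: sums_def partial)
qed

definition block_set :: "(nat \<Rightarrow> nat) \<Rightarrow> nat \<Rightarrow> real set" where
  "block_set l k =
     closure {x \<in> {0..1}. map (\<lambda>i. bin_digit x (l k + i)) [1..<Suc k] \<noteq> replicate k 0}"

definition tail_set :: "(nat \<Rightarrow> nat) \<Rightarrow> nat \<Rightarrow> real set" where
  "tail_set l n = (\<Inter>k\<in>{n..}. block_set l k)"

end

theory Submission
  imports Defs "HOL-Real_Asymp.Real_Asymp"
begin

text \<open>Let \<open>\<mu>\<close> have Fourier decay of order \<open>s > 0\<close>. The kernel \<open>Q\<^sub>k(x) = cos(\<pi>(2\<^sup>l x - c))\<^sup>2\<^sup>N\<close> with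
  \<open>l = l\<^sub>k\<close>, \<open>N = 16\<^sup>k\<close> and \<open>c = 2\<^sup>-\<^sup>k\<^sup>-\<^sup>1\<close> is a trigonometric polynomial in \<open>2\<^sup>l x\<close> with
  coefficients of total mass 1 and mean \<open>m\<^sub>k \<ge> 1/(2N)\<close>, while on \<open>A\<^sub>k\<close> it is super-exponentially
  small compared with \<open>m\<^sub>k\<close>. All non-constant frequencies have size at least \<open>2\<^sup>l\<close>, and
  \<open>2\<close> to the power \<open>-ls/2\<close> is negligible against \<open>m\<^sub>k\<close> because \<open>l\<^sub>k/k \<rightarrow> \<infinity>\<close>. Hence
  \<open>Q\<^sub>k/m\<^sub>k \<mu> \<rightarrow> \<mu>\<close> weakly, whereas \<open>Q\<^sub>k/m\<^sub>k \<rightarrow> 0\<close> uniformly on \<open>B\<^sub>n\<close>: no open interval of positive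
  measure can have \<open>\<mu>\<close>-almost all its points in one \<open>B\<^sub>n\<close>. If \<open>\<mu>\<close> lived on a compact subset of
  \<open>\<Union>B\<^sub>n\<close>, Baire's theorem on its support would produce such an interval.\<close>

section \<open>Cosine powers against measures with Fourier decay\<close>

text \<open>Binomial expansion of ((e^{it} + e^{-it}) / 2)^(2N). The even exponent makes every
  frequency an integer multiple of 2t and leaves a constant term, the one with j = N.\<close>

lemma cos_even_power_expansion:
  "complex_of_real (cos t ^ (2 * N)) =
     (\<Sum>j\<le>2*N. of_real (real ((2*N) choose j) / 4 ^ N) * exp (\<i> * of_real (2 * t * (real j - real N))))"
proof -
  have "complex_of_real (cos t ^ (2*N)) = ((exp (\<i> * of_real t) + exp (- (\<i> * of_real t))) / 2) ^ (2*N)"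
    by (simp add: cos_of_real [symmetric] cos_exp_eq)
  also have "\<dots> = (\<Sum>j\<le>2*N. of_nat ((2*N) choose j) * exp (\<i> * of_real t) ^ j *
      exp (- (\<i> * of_real t)) ^ (2*N - j)) / 4 ^ N"
    by (simp only: power_divide binomial_ring, simp add: power_mult)
  also have "\<dots> = (\<Sum>j\<le>2*N. of_real (real ((2*N) choose j) / 4 ^ N) *
      exp (\<i> * of_real (2 * t * (real j - real N))))"
    unfolding sum_divide_distrib
  proof (rule sum.cong)
    fix j assume "j \<in> {..2*N}"
    then have j: "j \<le> 2 * N" by simp
    have "exp (\<i> * of_real t) ^ j * exp (- (\<i> * complex_of_real t)) ^ (2*N - j)
        = exp (of_nat j * (\<i> * of_real t) + of_nat (2*N - j) * (- (\<i> * of_real t)))"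
      by (simp only: exp_of_nat_mult exp_add)
    also have "of_nat j * (\<i> * of_real t) + of_nat (2*N - j) * (- (\<i> * complex_of_real t))
        = \<i> * of_real (2 * t * (real j - real N))"
      using j by (simp add: of_nat_diff algebra_simps)
    finally show "of_nat ((2*N) choose j) * exp (\<i> * of_real t) ^ j *
        exp (- (\<i> * of_real t)) ^ (2*N - j) / 4 ^ N
      = of_real (real ((2*N) choose j) / 4 ^ N) * exp (\<i> * of_real (2 * t * (real j - real N)))"
      by (simp add: mult.assoc)
  qed simp
  finally show ?thesis .
qed

lemma sum_binomial_weights: "(\<Sum>j\<le>2*N. real ((2*N) choose j) / 4 ^ N) = 1"
proof -
  have "(\<Sum>j\<le>2*N. real ((2*N) choose j)) = 2 ^ (2*N)"
    using choose_row_sum[of "2*N"] by (metis of_nat_numeral of_nat_power of_nat_sum)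
  then show ?thesis by (simp add: sum_divide_distrib [symmetric] power_mult)
qed

text \<open>Expanding both powers, every term that is not constant in the second factor has frequency at
  least \<open>\<phi> - \<theta> J \<ge> R\<close>, and the coefficients of each expansion are nonnegative with sum 1.\<close>

lemma cos_power_integral_decorrelation:
  fixes \<mu> :: "real measure"
  assumes "prob_space \<mu>" and sets: "sets \<mu> = sets borel"
    and decay: "\<And>\<xi>. \<bar>\<xi>\<bar> \<ge> R \<Longrightarrow> norm (fourier_transform \<mu> \<xi>) \<le> \<epsilon>"
    and \<theta>: "0 \<le> \<theta>" "R + \<theta> * real J \<le> \<phi>"
  shows "\<bar>(LINT x|\<mu>. cos (pi * \<theta> * (x - a)) ^ (2*J) * cos (pi * \<phi> * (x - c)) ^ (2*N)) -
    real ((2*N) choose N) / 4 ^ N * (LINT x|\<mu>. cos (pi * \<theta> * (x - a)) ^ (2*J))\<bar> \<le> \<epsilon>"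
proof -
  interpret prob_space \<mu> by fact
  define q where "q N j = real ((2*N) choose j) / 4 ^ N" for N j :: nat
  have q: "q N j \<ge> 0" "(\<Sum>j\<le>2*N. q N j) = 1" for N j
    using sum_binomial_weights by (simp_all add: q_def)
  define g where "g x = cos (pi * \<theta> * (x - a)) ^ (2*J)" for x
  define e where "e \<psi> x = exp (\<i> * of_real (2 * pi * \<psi> * x))" for \<psi> x :: real
  have e_add: "e (\<psi> + \<psi>') x = e \<psi> x * e \<psi>' x" for \<psi> \<psi>' x
    by (simp add: e_def exp_add [symmetric] algebra_simps)
  have norm_e: "norm (e \<psi> x) = 1" for \<psi> x by (simp add: e_def)
  have [measurable]: "e \<psi> \<in> borel_measurable \<mu>" for \<psi>
    unfolding e_def measurable_cong_sets[OF sets refl]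
    by (intro borel_measurable_continuous_onI continuous_intros)
  have int_e [simp]: "integrable \<mu> (e \<psi>)" for \<psi>
    by (rule integrable_const_bound[where B = 1]) (simp_all add: norm_e)
  have exp: "complex_of_real (cos (pi * \<psi> * (x - b)) ^ (2*K)) =
      (\<Sum>j\<le>2*K. of_real (q K j) * e (- \<psi> * (real j - real K)) b * e (\<psi> * (real j - real K)) x)" for \<psi> b x K
    unfolding cos_even_power_expansion e_def q_def
    by (intro sum.cong refl) (simp add: exp_add [symmetric] algebra_simps)
  have FT: "(CLINT x|\<mu>. e \<psi> x) = fourier_transform \<mu> (- \<psi>)" for \<psi>
    by (simp add: fourier_transform_def e_def mult_ac)
  \<comment> \<open>\<open>\<bar>R\<bar>\<close> is an admissible frequency whatever the sign of
    \<open>R\<close>.\<close>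
  have eps: "\<epsilon> \<ge> 0" using decay[of "\<bar>R\<bar>"] by (meson abs_ge_self abs_idempotent dual_order.trans norm_ge_zero eq_refl)
  define F where "F j = (CLINT x|\<mu>. of_real (g x) * e (\<phi> * (real j - real N)) x)" for j
  have gexp: "of_real (g x) * e \<psi> x = (\<Sum>i\<le>2*J. of_real (q J i) * e (- \<theta> * (real i - real J)) a * e (\<theta> * (real i - real J) + \<psi>) x)"
    for \<psi> x
    unfolding g_def exp sum_distrib_right e_add by (simp add: mult.assoc)
  have gint [simp]: "integrable \<mu> (\<lambda>x. of_real (g x) * e \<psi> x)" for \<psi>
    unfolding gexp by (intro Bochner_Integration.integrable_sum integrable_mult_right int_e)
  have F_le: "norm (F j) \<le> \<epsilon>" if "j \<noteq> N" for j
  proof -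
    have "norm (F j) = norm (\<Sum>i\<le>2*J. of_real (q J i) * e (- \<theta> * (real i - real J)) a *
        fourier_transform \<mu> (- (\<theta> * (real i - real J) + \<phi> * (real j - real N))))"
      unfolding F_def gexp FT[symmetric] by (subst Bochner_Integration.integral_sum) simp_all
    also have "\<dots> \<le> (\<Sum>i\<le>2*J. q J i * \<epsilon>)"
    proof (rule sum_norm_le)
      fix i assume "i \<in> {..2*J}"
      then have "\<bar>real i - real J\<bar> \<le> real J" by auto
      then have 1: "\<bar>\<theta> * (real i - real J)\<bar> \<le> \<theta> * real J"
        using \<theta> by (simp add: abs_mult mult_left_mono)
      have "\<bar>\<phi> * (real j - real N)\<bar> \<ge> \<bar>\<phi>\<bar> * 1"
        using that unfolding abs_mult by (intro mult_left_mono) auto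
      with 1 \<theta> have "\<bar>- (\<theta> * (real i - real J) + \<phi> * (real j - real N))\<bar> \<ge> R" by linarith
      from decay[OF this] show "norm (of_real (q J i) * e (- \<theta> * (real i - real J)) a *
        fourier_transform \<mu> (- (\<theta> * (real i - real J) + \<phi> * (real j - real N)))) \<le> q J i * \<epsilon>"
        by (simp add: norm_mult norm_e q mult_left_mono)
    qed
    also have "\<dots> = \<epsilon>" by (simp add: sum_distrib_right [symmetric] q)
    finally show ?thesis .
  qed
  let ?G = "LINT x|\<mu>. g x"
  let ?w = "\<lambda>j. of_real (q N j) * e (- \<phi> * (real j - real N)) c"
  have FN: "F N = of_real ?G" by (simp add: F_def e_def)
  have "complex_of_real (LINT x|\<mu>. g x * cos (pi * \<phi> * (x - c)) ^ (2*N)) =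
      (CLINT x|\<mu>. (\<Sum>j\<le>2*N. ?w j * (of_real (g x) * e (\<phi> * (real j - real N)) x)))"
    unfolding integral_complex_of_real [symmetric] of_real_mult exp sum_distrib_left by (simp add: mult_ac)
  also have "\<dots> = (\<Sum>j\<le>2*N. ?w j * F j)"
    unfolding F_def by (subst Bochner_Integration.integral_sum) simp_all
  \<comment> \<open>The term j = N has frequency zero and phase 1, so its integral is that of
    \<open>g\<close>; all other terms are errors controlled by \<open>F_le\<close>.\<close>
  also have "\<dots> = of_real (q N N) * of_real ?G + (\<Sum>j\<in>{..2*N} - {N}. ?w j * F j)"
    by (subst sum.remove[of _ N]) (simp_all add: FN, simp add: e_def)
  finally have "norm (complex_of_real ((LINT x|\<mu>. g x * cos (pi * \<phi> * (x - c)) ^ (2*N)) - q N N * ?G))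
      = norm (\<Sum>j\<in>{..2*N} - {N}. ?w j * F j)"
    by simp
  also have "\<dots> \<le> (\<Sum>j\<in>{..2*N} - {N}. q N j * \<epsilon>)"
    by (rule sum_norm_le) (auto simp: norm_mult norm_e q intro!: mult_left_mono F_le)
  also have "\<dots> \<le> (\<Sum>j\<le>2*N. q N j * \<epsilon>)"
    by (rule sum_mono2) (auto simp: q eps)
  also have "\<dots> = \<epsilon>" by (simp add: sum_distrib_right [symmetric] q)
  finally show ?thesis unfolding norm_of_real g_def q_def .
qed

section \<open>Binary blocks and the sets \<open>A\<^sub>k\<close>\<close>

text \<open>An even floor of 2^(j+1) y is twice the floor of 2^j y, so k even floors in a row give
  floor(2^k y) = 2^k floor(y). Conversely, a fractional part below 2^-k stays below 1 through k
  doublings.\<close>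

lemma even_floors_iff:
  fixes y :: real
  shows "(\<forall>i\<in>{1..k}. even \<lfloor>2 ^ i * y\<rfloor>) \<longleftrightarrow> 2 ^ k * frac y < 1"
proof
  assume even: "\<forall>i\<in>{1..k}. even \<lfloor>2 ^ i * y\<rfloor>"
  have "j \<le> k \<Longrightarrow> \<lfloor>2 ^ j * y\<rfloor> = 2 ^ j * \<lfloor>y\<rfloor>" for j
  proof (induction j)
    case (Suc j)
    have "\<lfloor>2 ^ Suc j * y\<rfloor> div 2 = \<lfloor>2 ^ j * y\<rfloor>"
      using floor_divide_real_eq_div[of 2 "2 ^ Suc j * y"] by simp
    moreover have "even \<lfloor>2 ^ Suc j * y\<rfloor>" using even Suc.prems by (metis atLeastAtMost_iff le_add1 plus_1_eq_Suc)
    ultimately show ?case using Suc by (auto elim!: evenE)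
  qed simp
  from this[of k] have "2 ^ k * y < 2 ^ k * \<lfloor>y\<rfloor> + 1" by (simp add: floor_eq_iff)
  then show "2 ^ k * frac y < 1" by (simp add: frac_def algebra_simps)
next
  assume less: "2 ^ k * frac y < 1"
  show "\<forall>i\<in>{1..k}. even \<lfloor>2 ^ i * y\<rfloor>"
  proof
    fix i assume i: "i \<in> {1..k}"
    have "2 ^ i * frac y \<le> 2 ^ k * frac y" using i by (intro mult_right_mono) auto
    moreover have "2 ^ i * y = of_int (2 ^ i * \<lfloor>y\<rfloor>) + 2 ^ i * frac y"
      by (simp add: frac_def algebra_simps)
    ultimately have "\<lfloor>2 ^ i * y\<rfloor> = 2 ^ i * \<lfloor>y\<rfloor>"
      using less by (subst floor_eq_iff) auto
    then show "even \<lfloor>2 ^ i * y\<rfloor>" using i by simp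
  qed
qed

text \<open>Digits L+1, ..., L+k of x are the first k digits after the point of 2^L x. The point 1
  is exceptional because \<open>bin_digit\<close> gives it the expansion 0.111...\<close>

lemma zero_block_iff_frac:
  assumes "x \<noteq> 1"
  shows "map (\<lambda>i. bin_digit x (L + i)) [1..<Suc k] = replicate k 0 \<longleftrightarrow> frac (2 ^ L * x) < 1 / 2 ^ k"
proof -
  have "replicate k (0::int) = map (\<lambda>i. 0) [1..<Suc k]" by (simp add: map_replicate_const del: upt_Suc)
  then have "map (\<lambda>i. bin_digit x (L + i)) [1..<Suc k] = replicate k 0 \<longleftrightarrow>
      (\<forall>i\<in>{1..k}. bin_digit x (L + i) = 0)"
    by (simp only: map_eq_conv set_upt atLeastLessThanSuc_atLeastAtMost)
  also have "\<dots> \<longleftrightarrow> (\<forall>i\<in>{1..k}. even \<lfloor>2 ^ i * (2 ^ L * x)\<rfloor>)"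
    using assms by (simp add: bin_digit_def even_iff_mod_2_eq_zero power_add mult_ac)
  also have "\<dots> \<longleftrightarrow> frac (2 ^ L * x) < 1 / 2 ^ k"
    unfolding even_floors_iff by (simp add: field_simps)
  finally show ?thesis .
qed

text \<open>The squared cosine has period 1 in y and peaks at frac y = c, the midpoint of [0, 2c];
  outside that interval y is at distance at least c from every peak. Doubling the angle reduces the
  claim to monotonicity of the cosine on [0, pi].\<close>

lemma cos_power2_le_of_frac:
  fixes y c :: real
  assumes "0 \<le> c" "c \<le> 1/2" "2 * c \<le> frac y"
  shows "(cos (pi * (y - c)))\<^sup>2 \<le> (cos (pi * c))\<^sup>2"
proof -
  define u where "u = 2 * (frac y - c)"
  have "cos (2 * pi * (y - c)) = cos (pi * u + 2 * pi * of_int \<lfloor>y\<rfloor>)"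
    by (rule arg_cong[of _ _ cos]) (simp add: u_def frac_def algebra_simps)
  also have "\<dots> = cos (pi * u)"
    by (simp only: cos_add cos_int_2pin sin_int_2pin mult_1_right mult_zero_right diff_0_right)
  also have "\<dots> \<le> cos (pi * (2 * c))"
  proof (cases "u \<le> 1")
    case True
    then show ?thesis using assms
      by (intro cos_monotone_0_pi_le mult_left_mono mult_nonneg_nonneg) (auto simp: u_def)
  next
    case False
    \<comment> \<open>Past the half period, reflecting u to 2 - u brings the angle back into
      [0, pi].\<close>
    have "cos (pi * u) = cos (pi * (2 - u))" by (simp add: cos_diff algebra_simps)
    also have "\<dots> \<le> cos (pi * (2 * c))"
      using assms False frac_lt_1[of y]
      by (intro cos_monotone_0_pi_le mult_left_mono mult_nonneg_nonneg) (auto simp: u_def)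
    finally show ?thesis .
  qed
  finally have "cos (2 * (pi * (y - c))) \<le> cos (2 * (pi * c))" by (simp add: mult_ac)
  then show ?thesis unfolding cos_double_cos by simp
qed

text \<open>The shift 1/2^(k+1) centres the peaks of the cosine on the removed fractional parts [0,
  2^-k). The resulting bound is a closed condition, so it survives the closure in
  \<open>block_set\<close>.\<close>

lemma block_set_cos_le:
  assumes k: "k \<ge> 1" and x: "x \<in> block_set l k"
  shows "(cos (pi * 2 ^ l k * (x - 1 / 2 ^ Suc k / 2 ^ l k)))\<^sup>2 \<le> (cos (pi / 2 ^ Suc k))\<^sup>2"
proof -
  let ?S = "{x. (cos (pi * 2 ^ l k * (x - 1 / 2 ^ Suc k / 2 ^ l k)))\<^sup>2 \<le> (cos (pi / 2 ^ Suc k))\<^sup>2}"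
  have eq: "pi * 2 ^ l k * (x - 1 / 2 ^ Suc k / 2 ^ l k) = pi * (2 ^ l k * x - 1 / 2 ^ Suc k)" for x
    by (simp add: field_simps)
  have "block_set l k \<subseteq> ?S"
    unfolding block_set_def
  proof (rule closure_minimal)
    show "closed ?S" by (intro closed_Collect_le continuous_intros)
    show "{x \<in> {0..1}. map (\<lambda>i. bin_digit x (l k + i)) [1..<Suc k] \<noteq> replicate k 0} \<subseteq> ?S"
    proof safe
      fix x :: real
      assume x: "x \<in> {0..1}" and ne: "map (\<lambda>i. bin_digit x (l k + i)) [1..<Suc k] \<noteq> replicate k 0"
      show "(cos (pi * 2 ^ l k * (x - 1 / 2 ^ Suc k / 2 ^ l k)))\<^sup>2 \<le> (cos (pi / 2 ^ Suc k))\<^sup>2"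
      proof (cases "x = 1")
        case True
        \<comment> \<open>At x = 1 the digits say nothing about \<open>frac\<close>, but 2^l is an
          integer and the bound holds with equality.\<close>
        have "cos (pi * (2 ^ l k - 1 / 2 ^ Suc k)) = cos (pi / 2 ^ Suc k) * cos (2 ^ l k * pi)"
          using sin_npi[of "2 ^ l k"] by (simp add: right_diff_distrib cos_diff mult_ac)
        moreover have "(cos (2 ^ l k * pi))\<^sup>2 = 1"
          using cos_npi[of "2 ^ l k"] by (simp add: power_mult [symmetric])
        ultimately show ?thesis unfolding eq True by (simp add: power_mult_distrib)
      next
        case False
        from ne have "1 / 2 ^ k \<le> frac (2 ^ l k * x)" unfolding zero_block_iff_frac[OF False] not_less .
        then show ?thesis
          unfolding eq using cos_power2_le_of_frac[of "1 / 2 ^ Suc k" "2 ^ l k * x"]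
          by (simp add: field_simps)
      qed
    qed
  qed
  with x show ?thesis by auto
qed

lemma cos_power2_le_exp:
  fixes x :: real
  assumes "0 \<le> x" "x \<le> 1"
  shows "(cos x)\<^sup>2 \<le> exp (- x\<^sup>2 / 4)"
proof -
  have "\<bar>sin x - x\<bar> \<le> \<bar>x\<bar> ^ 3 / 6"
    using Maclaurin_sin_bound[of x 3] by (simp add: eval_nat_numeral sin_coeff_def fact_numeral)
  moreover have "\<bar>x\<bar> ^ 3 \<le> \<bar>x\<bar> ^ 1" using assms by (intro power_decreasing) auto
  ultimately have "x / 2 \<le> sin x" using assms by (simp add: abs_if split: if_splits)
  then have "(x / 2)\<^sup>2 \<le> (sin x)\<^sup>2" using assms by (intro power_mono) auto
  then have "(cos x)\<^sup>2 \<le> 1 + (- x\<^sup>2 / 4)" by (simp add: cos_squared_eq power_divide)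
  also have "\<dots> \<le> exp (- x\<^sup>2 / 4)" by (rule exp_ge_add_one_self)
  finally show ?thesis .
qed

text \<open>The bound on the squared base falls short of 1 by an amount of order 4^-k. Raising it to
  the power 16^k leaves the exponential of a negative multiple of 4^k, small enough to absorb the
  factor 16^k lost on dividing by the mean of the kernel.\<close>

lemma block_set_cos_power_le:
  assumes "k \<ge> 1" "x \<in> block_set l k"
  shows "cos (pi * 2 ^ l k * (x - 1 / 2 ^ Suc k / 2 ^ l k)) ^ (2 * 16 ^ k) \<le> exp (- (4 ^ k / 16))"
proof -
  let ?c = "pi / 2 ^ Suc k"
  have c: "0 \<le> ?c" "?c \<le> 1"
  proof -
    have "(2::real) ^ Suc 1 \<le> 2 ^ Suc k" using assms by (intro power_increasing) auto
    then show "?c \<le> 1" using pi_less_4 by simp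
  qed simp
  have "cos (pi * 2 ^ l k * (x - 1 / 2 ^ Suc k / 2 ^ l k)) ^ (2 * 16 ^ k) \<le> (exp (- ?c\<^sup>2 / 4)) ^ (16 ^ k)"
    unfolding power_mult
    using block_set_cos_le[OF assms] cos_power2_le_exp[OF c] by (intro power_mono) auto
  also have "\<dots> = exp (- (16 ^ k * ?c\<^sup>2 / 4))"
    by (simp add: exp_of_nat_mult [symmetric])
  also have "\<dots> \<le> exp (- (4 ^ k / 16))"
  proof -
    have "(16::real) ^ k = 4 ^ k * (2 ^ k)\<^sup>2"
      by (simp add: power_mult_distrib [symmetric] power2_eq_square mult.assoc)
    then have "16 ^ k * ?c\<^sup>2 / 4 = 4 ^ k * pi\<^sup>2 / 16"
      by (simp add: power_divide power_mult_distrib)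
    moreover have "1\<^sup>2 \<le> pi\<^sup>2" using pi_gt3 by (intro power_mono) auto
    then have "4 ^ k * 1 \<le> 4 ^ k * pi\<^sup>2" by (intro mult_left_mono) auto
    ultimately show ?thesis unfolding exp_le_cancel_iff neg_le_iff_le by linarith
  qed
  finally show ?thesis .
qed

section \<open>Compact Fourier dimension\<close>

lemma block_error_tendsto_0:
  assumes lim: "filterlim (\<lambda>k. real (l k) / real k) at_top sequentially" and s: "s > 0"
  shows "(\<lambda>k. 16 ^ k * (2 ^ l k / 2) powr (- s / 2)) \<longlonglongrightarrow> (0::real)"
proof (rule tendsto_sandwich[of "\<lambda>_. 0"])
  \<comment> \<open>The threshold 10/s makes the decay factor of order 2^(-5k), which beats 16^k =
    2^(4k) by 2^-k.\<close>
  have "\<forall>\<^sub>F k in sequentially. 10 / s \<le> real (l k) / real k"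
    using lim unfolding filterlim_at_top by blast
  then show "\<forall>\<^sub>F k in sequentially. 16 ^ k * (2 ^ l k / 2) powr (- s / 2) \<le> 2 powr (s / 2) * (1/2::real) ^ k"
    using eventually_gt_at_top[of 0]
  proof eventually_elim
    case (elim k)
    then have "5 * real k \<le> real (l k) * s / 2" using s by (simp add: field_simps)
    then have "4 * real k + (real (l k) - 1) * (- s / 2) \<le> s / 2 - real k"
      by (simp add: field_simps)
    have "(2::real) ^ l k / 2 = 2 powr (real (l k) - 1)" by (simp add: powr_diff powr_realpow)
    then have "(2 ^ l k / 2) powr (- s / 2) = 2 powr ((real (l k) - 1) * (- s / 2))"
      by (simp only: powr_powr)
    moreover have "(16::real) ^ k = 2 powr (4 * real k)"
      by (simp add: powr_powr [symmetric] powr_realpow)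
    ultimately have "16 ^ k * (2 ^ l k / 2) powr (- s / 2) = 2 powr (4 * real k + (real (l k) - 1) * (- s / 2))"
      by (simp only: powr_add)
    also have "\<dots> \<le> 2 powr (s / 2 - real k)" by (rule powr_mono) (fact, simp)
    also have "\<dots> = 2 powr (s / 2) * (1/2) ^ k" by (simp add: powr_diff powr_realpow power_one_over)
    finally show ?case .
  qed
  show "(\<lambda>k. 2 powr (s / 2) * (1/2::real) ^ k) \<longlonglongrightarrow> 0"
    by (intro tendsto_mult_right_zero LIMSEQ_realpow_zero) auto
qed simp_all

text \<open>The concentrated powers \<open>g J\<close> serve as test functions: comparing \<open>\<integral> g J\<close> on the ball
  \<open>ball a (r/2)\<close> (at least \<open>A\<^sup>J\<close> times its measure) with the bound \<open>B\<^sup>J\<close> coming from outside \<open>ball a r\<close>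
  and letting \<open>J \<rightarrow> \<infinity>\<close> avoids Fourier inversion for a cutoff function.\<close>

lemma null_ball_of_decay:
  assumes lim: "filterlim (\<lambda>k. real (l k) / real k) at_top sequentially"
    and "prob_space \<mu>" and sets: "sets \<mu> = sets borel"
    and decay: "fourier_decay s \<mu>" and s: "s > 0"
    and supp: "AE x in \<mu>. x \<in> {0..1}" and a: "a \<in> {0..1::real}" and r: "0 < r" "r \<le> 1"
    and ball: "AE x in \<mu>. x \<in> ball a r \<longrightarrow> x \<in> tail_set l n"
  shows "measure \<mu> (ball a (r / 2)) = 0"
proof -
  interpret prob_space \<mu> by fact
  have meas [measurable]: "f \<in> borel_measurable \<mu>" if "continuous_on UNIV f" for f :: "real \<Rightarrow> real"
    unfolding measurable_cong_sets[OF sets refl] using that by (rule borel_measurable_continuous_onI)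
  obtain M0 where M0: "\<And>\<xi>. \<xi> \<noteq> 0 \<Longrightarrow> norm (fourier_transform \<mu> \<xi>) \<le> M0 * \<bar>\<xi>\<bar> powr (- s / 2)"
    using decay by (auto simp: fourier_decay_def)
  define M where "M = max M0 0"
  define \<epsilon> where "\<epsilon> k = M * (2 ^ l k / 2) powr (- s / 2)" for k
  define \<tau> where "\<tau> k = exp (- (4 ^ k / 16) :: real)" for k :: nat
  \<comment> \<open>\<open>m k\<close> is the constant coefficient of the kernel \<open>Q k\<close>,
    that is, its mean over a period.\<close>
  define m where "m k = real ((2 * 16 ^ k) choose 16 ^ k) / 4 ^ 16 ^ k" for k :: nat
  \<comment> \<open>Values of the squared test cosine at distances r/2 and r from \<open>a\<close>.
    In \<open>g\<close> the frequency 1/2 keeps the angle within [-pi/2, pi/2] for x and a in [0,1],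
    so \<open>g\<close> does not increase with the distance from \<open>a\<close>.\<close>
  define A B where "A = (cos (pi * (1/2) * (r / 2)))\<^sup>2" and "B = (cos (pi * (1/2) * r))\<^sup>2"
  define g where "g J x = cos (pi * (1/2) * (x - a)) ^ (2 * J)" for J x
  define Q where "Q k x = cos (pi * 2 ^ l k * (x - 1 / 2 ^ Suc k / 2 ^ l k)) ^ (2 * 16 ^ k)" for k x
  have g_bounds: "0 \<le> g J x" "g J x \<le> 1" for J x
    by (auto simp: g_def power_mult intro!: power_le_one abs_square_le_1[THEN iffD2])
  have Q_bounds: "0 \<le> Q k x" "Q k x \<le> 1" for k x
    by (auto simp: Q_def power_mult intro!: power_le_one abs_square_le_1[THEN iffD2])
  have [measurable]: "g J \<in> borel_measurable \<mu>" "Q k \<in> borel_measurable \<mu>" for J k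
    unfolding g_def Q_def by (intro meas continuous_intros)+
  have int [simp]: "integrable \<mu> (g J)" "integrable \<mu> (Q k)" "integrable \<mu> (\<lambda>x. g J x * Q k x)" for J k
    using g_bounds Q_bounds
    by (auto intro!: integrable_const_bound[where B = 1] mult_le_one AE_I2)
  \<comment> \<open>Central binomial bound 4^N / (2N) \<le> C(2N, N) with N = 16^k: dividing by
    \<open>m k\<close> costs at most 2N.\<close>
  have m_le: "inverse (m k) \<le> 2 * 16 ^ k" and m_pos: "m k > 0" for k
  proof -
    show "m k > 0" by (simp add: m_def)
    have "1 / (2 * 16 ^ k) \<le> m k"
      using central_binomial_lower_bound[of "16 ^ k"] by (simp add: m_def field_simps)
    from le_imp_inverse_le[OF this] show "inverse (m k) \<le> 2 * 16 ^ k" by simp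
  qed
  have decay': "norm (fourier_transform \<mu> \<xi>) \<le> \<epsilon> k" if "2 ^ l k / 2 \<le> \<bar>\<xi>\<bar>" for \<xi> k
  proof -
    have pos: "(0::real) < 2 ^ l k / 2" by simp
    with that have "\<bar>\<xi>\<bar> > 0" by linarith
    then have "\<xi> \<noteq> 0" by simp
    from M0[OF this] have "norm (fourier_transform \<mu> \<xi>) \<le> M0 * \<bar>\<xi>\<bar> powr (- s / 2)" .
    also have "\<dots> \<le> M * \<bar>\<xi>\<bar> powr (- s / 2)" by (intro mult_right_mono) (auto simp: M_def)
    also have "\<dots> \<le> \<epsilon> k"
      unfolding \<epsilon>_def using that pos s by (intro mult_left_mono powr_mono2') (auto simp: M_def)
    finally show ?thesis .
  qed
  have \<epsilon>_lim: "(\<lambda>k. 2 * 16 ^ k * \<epsilon> k) \<longlonglongrightarrow> 0"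
    using tendsto_mult_left[OF block_error_tendsto_0[OF lim s], of "2 * M"] by (simp add: \<epsilon>_def mult_ac)
  have \<tau>_lim: "(\<lambda>k. 2 * 16 ^ k * \<tau> k) \<longlonglongrightarrow> 0"
    unfolding \<tau>_def by real_asymp
  have "filterlim (\<lambda>k. real (l k)) at_top sequentially"
  proof (rule filterlim_at_top_mono[OF filterlim_real_sequentially])
    have "\<forall>\<^sub>F k in sequentially. 1 \<le> real (l k) / real k"
      using lim unfolding filterlim_at_top by blast
    then show "\<forall>\<^sub>F k in sequentially. real k \<le> real (l k)"
      using eventually_gt_at_top[of 0] by eventually_elim (simp add: field_simps)
  qed
  then have l_large: "\<forall>\<^sub>F k in sequentially. C \<le> real (l k)" for C
    unfolding filterlim_at_top by blast
  have cos_abs: "cos (pi * (1/2) * \<bar>x - a\<bar>) = cos (pi * (1/2) * (x - a))" for x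
    using cos_abs_real[of "pi * (1/2) * (x - a)"] by (simp add: abs_mult)
  have cos_nonneg: "0 \<le> cos (pi * (1/2) * t)" if "0 \<le> t" "t \<le> 1" for t
    using that mult_left_mono[of t 1 "pi * (1/2)"] by (intro cos_ge_zero) (auto intro: order_trans[of _ 0])
  \<comment> \<open>With J fixed, the integral of \<open>g J\<close> times \<open>Q k\<close> is
    estimated from both sides and divided by \<open>m k\<close>; the error terms vanish as k
    grows.\<close>
  have g_le: "expectation (g J) \<le> B ^ J" for J
  proof (rule tendsto_lowerbound)
    show "(\<lambda>k. B ^ J + 2 * 16 ^ k * \<epsilon> k + 2 * 16 ^ k * \<tau> k + B ^ J * (2 * 16 ^ k * \<epsilon> k)) \<longlonglongrightarrow> B ^ J"
      using tendsto_add[OF tendsto_add[OF tendsto_add[OF tendsto_const \<epsilon>_lim] \<tau>_lim] tendsto_mult_left[OF \<epsilon>_lim]]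
      by simp
    show "\<forall>\<^sub>F k in sequentially. expectation (g J) \<le>
        B ^ J + 2 * 16 ^ k * \<epsilon> k + 2 * 16 ^ k * \<tau> k + B ^ J * (2 * 16 ^ k * \<epsilon> k)"
      using l_large[of "real J"] eventually_ge_at_top[of "max 1 n"]
    proof eventually_elim
      case (elim k)
      have "real J \<le> 2 ^ l k" using elim(1) of_nat_less_two_power[of "l k", where ?'a = real] by linarith
      \<comment> \<open>The test function has frequencies up to J/2, at most half of 2^l once l
        \<ge> J. The other half of 2^l is the threshold from which the decay is used.\<close>
      then have R: "2 ^ l k / 2 + 1/2 * real J \<le> 2 ^ l k" by linarith
      have \<epsilon>_pos: "\<epsilon> k \<ge> 0" by (simp add: \<epsilon>_def M_def)
      have gQ: "\<bar>(LINT x|\<mu>. g J x * Q k x) - m k * expectation (g J)\<bar> \<le> \<epsilon> k"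
        unfolding g_def Q_def m_def
        by (rule cos_power_integral_decorrelation[OF \<open>prob_space \<mu>\<close> sets decay' _ R]) auto
      \<comment> \<open>\<open>g 0\<close> is the constant 1, so the case J = 0 estimates the
        integral of \<open>Q k\<close> alone.\<close>
      have "\<bar>(LINT x|\<mu>. g 0 x * Q k x) - m k * (LINT x|\<mu>. g 0 x)\<bar> \<le> \<epsilon> k"
        unfolding g_def Q_def m_def
        by (rule cos_power_integral_decorrelation[OF \<open>prob_space \<mu>\<close> sets decay']) auto
      then have Q_le: "expectation (Q k) \<le> m k + \<epsilon> k"
        by (simp add: g_def prob_space abs_le_iff)
      \<comment> \<open>Inside the ball almost every point lies in A_k and \<open>Q k\<close> is at
        most \<open>\<tau> k\<close>; outside it \<open>g J\<close> is at most B^J. The sum of the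
        two nonnegative bounds covers both cases.\<close>
      have "(LINT x|\<mu>. g J x * Q k x) \<le> (LINT x|\<mu>. \<tau> k + B ^ J * Q k x)"
      proof (rule integral_mono_AE)
        show "AE x in \<mu>. g J x * Q k x \<le> \<tau> k + B ^ J * Q k x"
          using supp ball
        proof eventually_elim
          case (elim x)
          show ?case
          proof (cases "x \<in> ball a r")
            case True
            with elim \<open>max 1 n \<le> k\<close> have "x \<in> block_set l k" by (auto simp: tail_set_def)
            then have "Q k x \<le> \<tau> k"
              using \<open>max 1 n \<le> k\<close> block_set_cos_power_le[of k x l] by (simp add: Q_def \<tau>_def)
            moreover have "g J x * Q k x \<le> 1 * Q k x" using g_bounds Q_bounds by (intro mult_right_mono)
            moreover have "B ^ J * Q k x \<ge> 0" using Q_bounds by (simp add: B_def)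
            ultimately show ?thesis by linarith
          next
            case False
            have "cos (pi * (1/2) * \<bar>x - a\<bar>) \<le> cos (pi * (1/2) * r)"
              using False r elim a by (intro cos_monotone_0_pi_le mult_left_mono) (auto simp: dist_real_def abs_if split: if_splits)
            then have le: "cos (pi * (1/2) * (x - a)) \<le> cos (pi * (1/2) * r)" unfolding cos_abs .
            have "cos (pi * (1/2) * (x - a)) \<ge> 0"
              unfolding cos_abs [symmetric] using elim a by (intro cos_nonneg) auto
            with le have "g J x \<le> B ^ J"
              unfolding g_def B_def power_mult by (intro power_mono) auto
            then have "g J x * Q k x \<le> B ^ J * Q k x" using Q_bounds by (intro mult_right_mono)
            moreover have "\<tau> k \<ge> 0" by (simp add: \<tau>_def)
            ultimately show ?thesis by linarith
          qed
        qed
      qed simp_all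
      also have "\<dots> = \<tau> k + B ^ J * expectation (Q k)" by (simp add: prob_space)
      also have "\<dots> \<le> \<tau> k + B ^ J * (m k + \<epsilon> k)"
        using Q_le by (intro add_left_mono mult_left_mono) (auto simp: B_def)
      finally have "m k * expectation (g J) \<le> \<epsilon> k + \<tau> k + B ^ J * (m k + \<epsilon> k)" using gQ by linarith
      then have "expectation (g J) \<le> B ^ J + inverse (m k) * (\<epsilon> k + \<tau> k + B ^ J * \<epsilon> k)"
        using m_pos[of k] by (simp add: field_simps)
      also have "\<dots> \<le> B ^ J + 2 * 16 ^ k * (\<epsilon> k + \<tau> k + B ^ J * \<epsilon> k)"
        using m_le[of k] \<epsilon>_pos by (intro add_left_mono mult_right_mono) (auto simp: \<tau>_def B_def)
      finally show ?case by (simp add: algebra_simps)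
    qed
  qed simp
  have AB: "0 \<le> B" "B < A"
  proof -
    have "cos (pi * (1/2) * r) < cos (pi * (1/2) * (r / 2))"
      using r by (intro cos_monotone_0_pi) auto
    moreover have "0 \<le> cos (pi * (1/2) * r)"
      using r by (intro cos_nonneg) auto
    ultimately show "B < A" unfolding A_def B_def by (intro power_strict_mono) auto
  qed (simp add: B_def)
  have "prob (ball a (r / 2)) \<le> (B / A) ^ J" for J
  proof -
    have "prob (ball a (r / 2)) * A ^ J = (LINT x|\<mu>. indicator (ball a (r / 2)) x * A ^ J)"
      by (simp add: sets)
    also have "\<dots> \<le> expectation (g J)"
    proof (rule integral_mono)
      fix x
      show "indicator (ball a (r / 2)) x * A ^ J \<le> g J x"
      proof (cases "x \<in> ball a (r / 2)")
        case True
        have "cos (pi * (1/2) * (r / 2)) \<le> cos (pi * (1/2) * \<bar>x - a\<bar>)"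
          using True r by (intro cos_monotone_0_pi_le mult_left_mono) (auto simp: dist_real_def abs_minus_commute)
        then have "cos (pi * (1/2) * (r / 2)) \<le> cos (pi * (1/2) * (x - a))" unfolding cos_abs .
        moreover have "0 \<le> cos (pi * (1/2) * (r / 2))"
          using r by (intro cos_nonneg) auto
        ultimately show ?thesis
          using True unfolding g_def A_def power_mult by (auto intro!: power_mono)
      qed (simp add: g_bounds)
    qed (auto intro!: integrable_real_indicator simp: sets less_top [symmetric])
    finally have "prob (ball a (r / 2)) * A ^ J \<le> B ^ J" using g_le[of J] by linarith
    then show ?thesis using AB by (simp add: field_simps power_divide)
  qed
  moreover have "(\<lambda>J. (B / A) ^ J) \<longlonglongrightarrow> 0"
    using AB by (intro LIMSEQ_realpow_zero) auto
  ultimately have "prob (ball a (r / 2)) \<le> 0"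
    by (intro tendsto_lowerbound[of "\<lambda>J. (B / A) ^ J"]) auto
  then show ?thesis by (simp add: measure_le_0_iff)
qed

section \<open>Compactness of the sets, supports of measures and the Baire argument\<close>

lemma compact_block_set: "compact (block_set l k)"
  unfolding block_set_def by (rule compact_closure[THEN iffD2], rule bounded_subset[OF bounded_closed_interval]) auto

lemma block_set_subset: "block_set l k \<subseteq> {0..1}"
  unfolding block_set_def by (rule closure_minimal) auto

lemma compact_tail_set: "compact (tail_set l n)"
  unfolding tail_set_def by (rule compact_Inter) (auto simp: compact_block_set)

lemma tail_set_subset: "tail_set l n \<subseteq> {0..1}"
  using block_set_subset[of l n] by (auto simp: tail_set_def)

text \<open>By Lindelof the union of all null open sets is already a countable union of them, hence
  null; its complement is the support.\<close>

lemma AE_in_support: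
  fixes \<mu> :: "'a::second_countable_topology measure"
  assumes "sets \<mu> = sets borel"
  shows "AE x in \<mu>. \<forall>U. open U \<longrightarrow> x \<in> U \<longrightarrow> emeasure \<mu> U \<noteq> 0"
proof -
  obtain \<V> where \<V>: "\<V> \<subseteq> {U. open U \<and> emeasure \<mu> U = 0}" "countable \<V>" "\<Union>\<V> = \<Union>{U. open U \<and> emeasure \<mu> U = 0}"
    by (rule Lindelof[of "{U. open U \<and> emeasure \<mu> U = 0}"]) auto
  have "\<Union>\<V> \<in> null_sets \<mu>"
    using \<V> assms by (intro null_sets_UN'[where N = "\<lambda>x. x", simplified]) (auto simp: null_sets_def)
  then have "AE x in \<mu>. x \<notin> \<Union>\<V>" by (rule AE_not_in)
  then show ?thesis unfolding \<V>(3) by eventually_elim auto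
qed

text \<open>On the support S of the measure in K the relatively open sets S - B_n have empty
  intersection. By Baire one of them is not dense in S, so near some point a of S the support lies
  in a single B_n. Positive decay then makes a ball about a null, although a is in the
  support.\<close>

lemma fourier_decay_exponent_nonpos:
  assumes lim: "filterlim (\<lambda>k. real (l k) / real k) at_top sequentially"
    and K: "compact K" "K \<subseteq> (\<Union>n\<in>{1..}. tail_set l n)"
    and \<mu>: "\<mu> \<in> prob_measures_on K" and decay: "fourier_decay s \<mu>"
  shows "s \<le> 0"
proof (rule ccontr)
  assume "\<not> s \<le> 0"
  then have s: "s > 0" by simp
  have "prob_space \<mu>" and sets: "sets \<mu> = sets borel" and \<mu>K: "emeasure \<mu> K = 1"
    using \<mu> by (auto simp: prob_measures_on_def)
  interpret prob_space \<mu> by fact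
  have Kc: "closed K" using K by (simp add: compact_imp_closed)
  define S where "S = {x \<in> K. \<forall>U. open U \<longrightarrow> x \<in> U \<longrightarrow> emeasure \<mu> U \<noteq> 0}"
  have K01: "K \<subseteq> {0..1}" using K(2) tail_set_subset by fastforce
  have "S = K - \<Union>{U. open U \<and> emeasure \<mu> U = 0}" by (auto simp: S_def)
  then have "closed S" using Kc by (auto intro: closed_Diff)
  have "AE x in \<mu>. x \<in> K"
    using \<mu>K Kc sets by (subst AE_in_set_eq_1) (auto simp: measure_def)
  then have AE_S: "AE x in \<mu>. x \<in> S"
    using AE_in_support[OF sets] by eventually_elim (auto simp: S_def)
  have "S \<noteq> {}"
  proof
    assume "S = {}"
    with AE_S show False by (simp add: AE_False)
  qed
  have "\<exists>n\<ge>1. \<not> S \<subseteq> closure (S - tail_set l n)"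
  proof (rule ccontr)
    assume dense: "\<not> (\<exists>n\<ge>1. \<not> S \<subseteq> closure (S - tail_set l n))"
    have "S \<subseteq> closure (\<Inter>((\<lambda>n. S - tail_set l n) ` {1..}))"
    proof (rule Baire[OF \<open>closed S\<close>])
      fix T assume "T \<in> (\<lambda>n. S - tail_set l n) ` {1..}"
      then obtain n where "n \<ge> 1" "T = S - tail_set l n" by auto
      then show "openin (top_of_set S) T \<and> S \<subseteq> closure T"
        using dense compact_imp_closed[OF compact_tail_set[of l n]] by (auto simp: openin_open intro!: exI[of _ "- tail_set l n"])
    qed auto
    also have "\<Inter>((\<lambda>n. S - tail_set l n) ` {1..}) = {}"
      using K(2) by (fastforce simp: S_def)
    finally show False using \<open>S \<noteq> {}\<close> by simp
  qed
  then obtain n a where "n \<ge> 1" "a \<in> S" and a: "a \<notin> closure (S - tail_set l n)" by auto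
  then obtain e where e: "e > 0" "ball a e \<inter> (S - tail_set l n) = {}"
    by (auto simp: closure_approachable disjoint_iff dist_commute)
  \<comment> \<open>The cap at 1 meets the condition r \<le> 1 of \<open>null_ball_of_decay\<close>,
    which keeps cos(pi r / 2) nonnegative.\<close>
  define r where "r = min e 1"
  have r: "0 < r" "r \<le> 1" "r \<le> e" using e by (auto simp: r_def)
  have "measure \<mu> (ball a (r / 2)) = 0"
  proof (rule null_ball_of_decay[OF lim \<open>prob_space \<mu>\<close> sets decay s])
    show "AE x in \<mu>. x \<in> {0..1}" using AE_S by eventually_elim (use K01 in \<open>auto simp: S_def\<close>)
    show "a \<in> {0..1}" using \<open>a \<in> S\<close> K01 by (auto simp: S_def)
    show "AE x in \<mu>. x \<in> ball a r \<longrightarrow> x \<in> tail_set l n"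
      using AE_S by eventually_elim (use e(2) r(3) in \<open>fastforce simp: disjoint_iff\<close>)
  qed (use r in auto)
  then have "emeasure \<mu> (ball a (r / 2)) = 0" by (simp add: emeasure_eq_measure)
  moreover have "a \<in> ball a (r / 2)" using r by simp
  ultimately show False using \<open>a \<in> S\<close> by (auto simp: S_def)
qed

lemma compact_fourier_dim_tail_sets:
  assumes "filterlim (\<lambda>k. real (l k) / real k) at_top sequentially"
  shows "compact_fourier_dim (\<Union>n\<in>{1..}. tail_set l n) = 0"
  unfolding compact_fourier_dim_def
proof (rule antisym[OF Sup_least])
  fix t :: ennreal
  assume "t \<in> {ennreal s |s. s \<in> {0..real DIM(real)} \<and> (\<exists>K. compact K \<and> K \<subseteq> (\<Union>n\<in>{1..}. tail_set l n) \<and>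
    (\<exists>\<mu>\<in>prob_measures_on K. fourier_decay s \<mu>))}"
  then obtain s K \<mu> where "t = ennreal s" "compact K" "K \<subseteq> (\<Union>n\<in>{1..}. tail_set l n)"
      "\<mu> \<in> prob_measures_on K" "fourier_decay s \<mu>"
    by blast
  then show "t \<le> 0" using fourier_decay_exponent_nonpos[OF assms] by (simp add: ennreal_neg)
qed simp

text \<open>A compact \<open>K\<close> is its own compact witness. Applied to each B_n inside the
  union, this turns the vanishing of the compact dimension into dim_F B_n = 0.\<close>

lemma fourier_dim_le_compact_fourier_dim:
  assumes "compact K" "K \<subseteq> A"
  shows "fourier_dim K \<le> compact_fourier_dim A"
  unfolding fourier_dim_def compact_fourier_dim_def using assms by (intro Sup_subset_mono) blast

section \<open>Lebesgue measure\<close>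

lemma prob_space_unit_interval: "prob_space (uniform_measure lborel {0..1::real})"
  by (rule prob_space_uniform_measure) auto

lemma measure_uniform_unit_interval_Icc:
  "a \<le> b \<Longrightarrow> measure (uniform_measure lborel {0..1::real}) {a..b} \<le> b - a"
proof -
  assume "a \<le> b"
  have "measure (uniform_measure lborel {0..1::real}) {a..b} = measure lborel ({0..1} \<inter> {a..b})"
    by (simp add: measure_uniform_measure)
  also have "\<dots> \<le> measure lborel {a..b}" by (rule measure_mono_fmeasurable) (use \<open>a \<le> b\<close> in \<open>auto simp: fmeasurable_def\<close>)
  finally show ?thesis using \<open>a \<le> b\<close> by simp
qed

text \<open>A point outside the closure is outside the set itself, so its block vanishes and 2^l x
  lies at most 2^-k above an integer j < 2^l.\<close>

lemma compl_block_set_subset: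
  "{0..1} - block_set l k \<subseteq> (\<Union>j<(2::nat) ^ l k. {real j / 2 ^ l k .. real j / 2 ^ l k + 1 / 2 ^ k / 2 ^ l k})"
proof
  fix x assume x: "x \<in> {0..1} - block_set l k"
  have "{x \<in> {0..1}. map (\<lambda>i. bin_digit x (l k + i)) [1..<Suc k] \<noteq> replicate k 0} \<subseteq> block_set l k"
    unfolding block_set_def by (rule closure_subset)
  with x have "x \<notin> {x \<in> {0..1}. map (\<lambda>i. bin_digit x (l k + i)) [1..<Suc k] \<noteq> replicate k 0}"
    by (meson DiffD2 subsetD)
  moreover have "x \<in> {0..1}" using x by (rule DiffD1)
  ultimately have zeros: "map (\<lambda>i. bin_digit x (l k + i)) [1..<Suc k] = replicate k 0"
    by (simp only: mem_Collect_eq simp_thms)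
  show "x \<in> (\<Union>j<(2::nat) ^ l k. {real j / 2 ^ l k .. real j / 2 ^ l k + 1 / 2 ^ k / 2 ^ l k})"
  proof (cases "x = 1")
    case True
    show ?thesis
    \<comment> \<open>All digits of 1 are 1, so its block vanishes only when empty, for k = 0; the
      last interval then ends at 1.\<close>
    proof (cases k)
      case 0
      show ?thesis unfolding True 0 by (rule UN_I[of "2 ^ l 0 - 1"]) (auto simp: of_nat_diff field_simps)
    next
      case (Suc k')
      then have "k \<ge> 1" by simp
      then have "map (\<lambda>i. bin_digit x (l k + i)) [1..<Suc k] ! 0 = 1"
        using True by (simp add: bin_digit_def del: upt_Suc)
      with zeros Suc show ?thesis by simp
    qed
  next
    case False
    then have frac: "frac (2 ^ l k * x) < 1 / 2 ^ k" using zeros by (rule zero_block_iff_frac[THEN iffD1])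
    define j where "j = nat \<lfloor>2 ^ l k * x\<rfloor>"
    have j: "real j = of_int \<lfloor>2 ^ l k * x\<rfloor>" using x by (simp add: j_def)
    then have "real j \<le> 2 ^ l k * x" "2 ^ l k * x \<le> real j + 1 / 2 ^ k"
      using frac by (auto simp: frac_def)
    moreover have "2 ^ l k * x < 2 ^ l k" using x False by simp
    ultimately have "real j < 2 ^ l k" by linarith
    then have "j < 2 ^ l k" by simp
    then show ?thesis
      using \<open>real j \<le> 2 ^ l k * x\<close> \<open>2 ^ l k * x \<le> real j + 1 / 2 ^ k\<close>
      by (intro UN_I[of j]) (auto simp: field_simps)
  qed
qed

text \<open>The cover has 2^l intervals of length 2^(-k-l), so the block position l cancels and the
  bounds are summable in k.\<close>

lemma measure_compl_block_set:
  "measure (uniform_measure lborel {0..1}) (- block_set l k) \<le> 1 / 2 ^ k"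
proof -
  interpret prob_space "uniform_measure lborel {0..1::real}" by (rule prob_space_unit_interval)
  have [measurable]: "block_set l k \<in> sets borel"
    using compact_block_set[of l k] by (simp add: compact_imp_closed)
  have "prob (- block_set l k) = prob ({0..1} - block_set l k)"
    by (simp add: measure_uniform_measure Diff_eq)
  also have "\<dots> \<le> prob (\<Union>j<(2::nat) ^ l k. {real j / 2 ^ l k .. real j / 2 ^ l k + 1 / 2 ^ k / 2 ^ l k})"
    by (rule finite_measure_mono[OF compl_block_set_subset]) simp
  also have "\<dots> \<le> (\<Sum>j<(2::nat) ^ l k. prob {real j / 2 ^ l k .. real j / 2 ^ l k + 1 / 2 ^ k / 2 ^ l k})"
    by (rule finite_measure_subadditive_finite) auto
  also have "\<dots> \<le> (\<Sum>j<(2::nat) ^ l k. 1 / 2 ^ k / 2 ^ l k)"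
    by (intro sum_mono order_trans[OF measure_uniform_unit_interval_Icc]) auto
  finally show ?thesis by simp
qed

lemma measure_tail_set_ge:
  assumes "n \<ge> 1"
  shows "measure (uniform_measure lborel {0..1}) (tail_set l n) \<ge> 1 - 1 / 2 ^ (n - 1)"
proof -
  interpret prob_space "uniform_measure lborel {0..1::real}" by (rule prob_space_unit_interval)
  have [measurable]: "block_set l k \<in> sets borel" "tail_set l k \<in> sets borel" for k
    using compact_block_set[of l k] compact_tail_set[of l k] by (simp_all add: compact_imp_closed)
  \<comment> \<open>The geometric tail from n on, reindexed from 0, totals 2 / 2^n =
    2^-(n-1).\<close>
  have sums: "(\<lambda>k. 1 / 2 ^ n * (1 / 2) ^ k) sums (1 / 2 ^ n * 2 :: real)"
    using geometric_sums[of "1/2 :: real"] by (intro sums_mult) simp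
  have le: "prob (- block_set l (k + n)) \<le> 1 / 2 ^ n * (1 / 2) ^ k" for k
    using measure_compl_block_set[of l "k + n"] by (simp add: power_add power_one_over mult.commute)
  have summable: "summable (\<lambda>k. prob (- block_set l (k + n)))"
    by (rule summable_comparison_test'[OF sums_summable[OF sums], of 0]) (use le in simp)
  have compl: "- tail_set l n = (\<Union>k. - block_set l (k + n))"
    unfolding tail_set_def by (auto intro!: bexI) (metis le_add_diff_inverse2)
  have "prob (- tail_set l n) \<le> (\<Sum>k. prob (- block_set l (k + n)))"
    unfolding compl by (rule finite_measure_subadditive_countably[OF _ summable]) auto
  also have "\<dots> \<le> 1 / 2 ^ n * 2"
    using le summable sums by (intro sums_le[OF _ summable_sums sums]) auto
  also have "\<dots> = 1 / 2 ^ (n - 1)" using assms by (cases n) auto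
  finally show ?thesis using prob_compl[of "tail_set l n"] by (simp add: Compl_eq_Diff_UNIV)
qed

lemma measure_Union_tail_sets:
  "measure (uniform_measure lborel {0..1}) (\<Union>n\<in>{1..}. tail_set l n) = 1"
proof -
  interpret prob_space "uniform_measure lborel {0..1::real}" by (rule prob_space_unit_interval)
  have [measurable]: "tail_set l k \<in> sets borel" for k
    using compact_tail_set[of l k] by (simp add: compact_imp_closed)
  have "1 - (1 / 2) ^ n \<le> prob (\<Union>n\<in>{1..}. tail_set l n)" for n
  proof -
    have "1 - (1 / 2) ^ n \<le> prob (tail_set l (Suc n))"
      using measure_tail_set_ge[of "Suc n" l] by (simp add: power_one_over)
    also have "\<dots> \<le> prob (\<Union>n\<in>{1..}. tail_set l n)"
      by (rule finite_measure_mono) auto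
    finally show ?thesis .
  qed
  moreover have "(\<lambda>n. 1 - (1 / 2) ^ n) \<longlonglongrightarrow> (1 - 0 :: real)"
    by (intro tendsto_intros LIMSEQ_realpow_zero) auto
  ultimately have "1 \<le> prob (\<Union>n\<in>{1..}. tail_set l n)"
    by (intro tendsto_upperbound[of "\<lambda>n. 1 - (1 / 2) ^ n" _ sequentially]) auto
  with prob_le_1[of "\<Union>n\<in>{1..}. tail_set l n"] show ?thesis by linarith
qed

text \<open>The estimates are proved for \<open>uniform_measure\<close>, a Borel probability measure
  on the whole line as \<open>prob_measures_on\<close> demands; this carries them over to Lebesgue
  measure on [0,1].\<close>

lemma measure_lebesgue_on_unit_interval:
  assumes "A \<in> sets borel" "A \<subseteq> {0..1::real}"
  shows "measure (lebesgue_on {0..1}) A = measure (uniform_measure lborel {0..1}) A"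
proof -
  have "{0..1} \<inter> A = A" using assms by auto
  then show ?thesis
    using assms by (simp add: measure_restrict_space measure_uniform_measure measure_completion)
qed

text \<open>For frequencies above 1 in absolute value, integrating the exponential gives decay of
  order 1, better than the order 1/2 asked for; for the others the trivial bound 1 is
  enough.\<close>

lemma fourier_decay_unit_interval: "fourier_decay 1 (uniform_measure lborel {0..1::real})"
  unfolding fourier_decay_def
proof (intro exI[of _ 1] allI impI)
  fix \<xi> :: real assume \<xi>: "\<xi> \<noteq> 0"
  let ?P = "uniform_measure lborel {0..1::real}"
  interpret prob_space ?P by (rule prob_space_unit_interval)
  have P_density: "?P = density lborel (\<lambda>x. ennreal (indicator {0..1} x))"
    by (simp add: uniform_measure_def ennreal_indicator divide_ennreal_def)
  define c where "c = - (2 * of_real pi * \<i> * complex_of_real \<xi>)"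
  have c: "c \<noteq> 0" "norm c = 2 * pi * \<bar>\<xi>\<bar>" using \<xi> by (simp_all add: c_def norm_mult)
  have norm1: "norm (exp (c * of_real x)) = 1" for x :: real by (simp add: c_def)
  have FT: "fourier_transform ?P \<xi> = (CLINT x|?P. exp (c * of_real x))"
    by (simp add: fourier_transform_def c_def mult_ac)
  show "norm (fourier_transform ?P \<xi>) \<le> 1 * norm \<xi> powr (- 1 / 2)"
  proof (cases "\<bar>\<xi>\<bar> \<le> 1")
    case True
    have "norm (fourier_transform ?P \<xi>) \<le> (LINT x|?P. norm (exp (c * of_real x)))"
      unfolding FT by (rule integral_norm_bound)
    also have "\<dots> = 1" using prob_space by (simp only: norm1) simp
    also have "1 \<le> \<bar>\<xi>\<bar> powr (- 1 / 2)"
      using powr_mono2'[of "- 1 / 2" "\<bar>\<xi>\<bar>" 1] True \<xi> by simp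
    finally show ?thesis by simp
  next
    case False
    have "fourier_transform ?P \<xi> = (CLBINT x. indicator {0..1} x *\<^sub>R exp (c * of_real x))"
      unfolding FT by (subst P_density, subst integral_density) auto
    also have "\<dots> = exp (c * of_real 1) / c - exp (c * of_real 0) / c"
    proof (rule integral_FTC_atLeastAtMost)
      fix x :: real
      have "((\<lambda>z. exp (c * z) / c) has_field_derivative exp (c * of_real x)) (at (of_real x))"
        using c by (auto intro!: derivative_eq_intros)
      from has_vector_derivative_real_field[OF this]
      show "((\<lambda>x. exp (c * of_real x) / c) has_vector_derivative exp (c * of_real x)) (at x within {0..1})"
        by (simp add: o_def has_vector_derivative_at_within)
    qed (auto intro!: continuous_intros)
    also have "norm \<dots> \<le> norm (exp (c * of_real 1) / c) + norm (exp (c * of_real 0) / c)"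
      by (rule norm_triangle_ineq4)
    also have "\<dots> = 2 / (2 * pi * \<bar>\<xi>\<bar>)" unfolding norm_divide norm1 c by simp
    also have "\<dots> \<le> 1 / \<bar>\<xi>\<bar>" using \<xi> pi_gt3 by (simp add: field_simps)
    also have "\<dots> = \<bar>\<xi>\<bar> powr (- 1)" using \<xi> by (simp add: powr_minus_divide)
    also have "\<dots> \<le> \<bar>\<xi>\<bar> powr (- 1 / 2)" using False by (intro powr_mono) auto
    finally show ?thesis by simp
  qed
qed

text \<open>The upper bound is built into the definition by the cap \<open>DIM(real)\<close>, and
  the uniform distribution on [0,1] attains it.\<close>

lemma fourier_dim_eq_1_of_full_measure:
  assumes "A \<in> sets borel" "measure (uniform_measure lborel {0..1}) A = 1"
  shows "fourier_dim (A :: real set) = 1"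
  unfolding fourier_dim_def
proof (rule antisym[OF Sup_least Sup_upper])
  interpret prob_space "uniform_measure lborel {0..1::real}" by (rule prob_space_unit_interval)
  have "uniform_measure lborel {0..1::real} \<in> prob_measures_on A"
    using assms prob_space_unit_interval by (simp add: prob_measures_on_def emeasure_eq_measure)
  with fourier_decay_unit_interval
  show "1 \<in> {ennreal s |s. s \<in> {0..real DIM(real)} \<and> (\<exists>\<mu>\<in>prob_measures_on A. fourier_decay s \<mu>)}"
    by (auto intro!: exI[of _ 1])
qed auto

section \<open>Collected properties of the sets B_n and the two consequences\<close>

lemma tail_set_properties:
  assumes lim: "filterlim (\<lambda>k. real (l k) / real k) at_top sequentially"
  shows "\<forall>k\<ge>1. compact (block_set l k)"
    and "\<forall>n\<ge>1. fourier_dim (tail_set l n) = 0"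
    and "\<forall>n\<ge>1. measure (lebesgue_on {0..1}) (tail_set l n) \<ge> 1 - 1 / 2 ^ (n - 1)"
    and "measure (lebesgue_on {0..1}) (\<Union>n\<in>{1..}. tail_set l n) = 1"
    and "fourier_dim (\<Union>n\<in>{1..}. tail_set l n) = 1"
    and "compact_fourier_dim (\<Union>n\<in>{1..}. tail_set l n) = 0"
    and "(\<Union>n\<in>{1..}. tail_set l n) \<in> sets borel"
proof -
  have tail_borel [measurable]: "tail_set l n \<in> sets borel" for n
    using compact_tail_set[of l n] by (simp add: compact_imp_closed)
  show borel: "(\<Union>n\<in>{1..}. tail_set l n) \<in> sets borel" by measurable
  have sub: "(\<Union>n\<in>{1..}. tail_set l n) \<subseteq> {0..1}" using tail_set_subset by blast
  show "\<forall>k\<ge>1. compact (block_set l k)" by (simp add: compact_block_set)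
  show FC: "compact_fourier_dim (\<Union>n\<in>{1..}. tail_set l n) = 0"
    by (rule compact_fourier_dim_tail_sets[OF lim])
  show "\<forall>n\<ge>1. fourier_dim (tail_set l n) = 0"
  proof (intro allI impI)
    fix n :: nat assume "n \<ge> 1"
    then have "fourier_dim (tail_set l n) \<le> compact_fourier_dim (\<Union>n\<in>{1..}. tail_set l n)"
      by (intro fourier_dim_le_compact_fourier_dim compact_tail_set) auto
    then show "fourier_dim (tail_set l n) = 0" unfolding FC by simp
  qed
  show "\<forall>n\<ge>1. measure (lebesgue_on {0..1}) (tail_set l n) \<ge> 1 - 1 / 2 ^ (n - 1)"
    unfolding measure_lebesgue_on_unit_interval[OF tail_borel tail_set_subset] by (intro allI impI measure_tail_set_ge)
  show "measure (lebesgue_on {0..1}) (\<Union>n\<in>{1..}. tail_set l n) = 1"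
    unfolding measure_lebesgue_on_unit_interval[OF borel sub] by (rule measure_Union_tail_sets)
  show "fourier_dim (\<Union>n\<in>{1..}. tail_set l n) = 1"
    by (rule fourier_dim_eq_1_of_full_measure[OF borel measure_Union_tail_sets])
qed

theorem mainTheorem3:
  "(\<forall>l :: nat \<Rightarrow> nat.
      strict_mono_on {1..} l \<longrightarrow>
      filterlim (\<lambda>k. real (l k) / real k) at_top sequentially \<longrightarrow>
      (\<forall>k\<ge>1. compact (block_set l k)) \<and>
      (\<forall>n\<ge>1. fourier_dim (tail_set l n) = 0) \<and>
      (\<forall>n\<ge>1. measure (lebesgue_on {0..1}) (tail_set l n) \<ge> 1 - 1 / 2 ^ (n - 1)) \<and>
      measure (lebesgue_on {0..1}) (\<Union>n\<in>{1..}. tail_set l n) = 1 \<and>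
      fourier_dim (\<Union>n\<in>{1..}. tail_set l n) = 1 \<and>
      compact_fourier_dim (\<Union>n\<in>{1..}. tail_set l n) = 0) \<and>
   \<not> countably_stable (fourier_dim :: real set \<Rightarrow> ennreal) \<and>
   (\<exists>A :: real set. A \<in> sets borel \<and> compact_fourier_dim A \<noteq> fourier_dim A)"
proof (intro conjI)
  show "\<forall>l :: nat \<Rightarrow> nat.
      strict_mono_on {1..} l \<longrightarrow>
      filterlim (\<lambda>k. real (l k) / real k) at_top sequentially \<longrightarrow>
      (\<forall>k\<ge>1. compact (block_set l k)) \<and>
      (\<forall>n\<ge>1. fourier_dim (tail_set l n) = 0) \<and>
      (\<forall>n\<ge>1. measure (lebesgue_on {0..1}) (tail_set l n) \<ge> 1 - 1 / 2 ^ (n - 1)) \<and>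
      measure (lebesgue_on {0..1}) (\<Union>n\<in>{1..}. tail_set l n) = 1 \<and>
      fourier_dim (\<Union>n\<in>{1..}. tail_set l n) = 1 \<and>
      compact_fourier_dim (\<Union>n\<in>{1..}. tail_set l n) = 0"
    by (intro allI impI conjI tail_set_properties(1-6))
  \<comment> \<open>Squares give l_k / k = k, which tends to infinity.\<close>
  define l :: "nat \<Rightarrow> nat" where "l k = k\<^sup>2" for k
  have lim: "filterlim (\<lambda>k. real (l k) / real k) at_top sequentially"
    unfolding l_def by real_asymp
  note l = tail_set_properties[OF lim]
  show "\<not> countably_stable (fourier_dim :: real set \<Rightarrow> ennreal)"
  proof
    assume "countably_stable (fourier_dim :: real set \<Rightarrow> ennreal)"
    \<comment> \<open>The sets B_n start at n = 1 while \<open>countably_stable\<close> indexes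
      families from 0, hence the shift by \<open>Suc\<close>.\<close>
    note stable = this[unfolded countably_stable_def, rule_format, of "\<lambda>k. tail_set l (Suc k)"]
    have "fourier_dim (\<Union>k. tail_set l (Suc k)) = (SUP k. fourier_dim (tail_set l (Suc k)))"
      by (rule stable) (simp add: compact_tail_set compact_imp_closed)
    moreover have "(\<Union>k. tail_set l (Suc k)) = (\<Union>n\<in>{1..}. tail_set l n)"
      by (auto simp: Bex_def dest: Suc_le_D)
    moreover have "fourier_dim (tail_set l (Suc k)) = 0" for k using l(2) by simp
    ultimately show False using l(5) by simp
  qed
  show "\<exists>A :: real set. A \<in> sets borel \<and> compact_fourier_dim A \<noteq> fourier_dim A"
  proof (intro exI conjI)
    show "(\<Union>n\<in>{1..}. tail_set l n) \<in> sets borel" by (rule l(7))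
    show "compact_fourier_dim (\<Union>n\<in>{1..}. tail_set l n) \<noteq> fourier_dim (\<Union>n\<in>{1..}. tail_set l n)"
      unfolding l(5,6) by simp
  qed
qed

end
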